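(* There exists a real number $\alpha>1.61226$ such that $\neg SD(0,1,2,\infty;\alpha)$ holds. That is, there exists a finite set $G\subset\mathbb{R}^2$ such that $\pi_{-1}$ is injective on $G$ and $$\alpha=\frac{\log|G|}{\max\{\log|\pi_0(G)|,\ \log|\pi_1(G)|,\ \log|\pi_2(G)|,\ \log|\pi_\infty(G)|\}}.$$
   Context: For $r\in\mathbb{Q}\cup\{\infty\}$ define $\pi_r:\mathbb{R}^2\to\mathbb{R}$ by $\pi_r(a,b)=a+rb$, with the convention $\pi_\infty(a,b)=b$. For a finite set $A$, $|A|$ denotes its cardinality. For $r_1,\dots,r_n\in\mathbb{Q}\cup\{\infty\}\setminus\{-1\}$ and a real number $\alpha$, the statement $\neg SD(r_1,\dots,r_n;\alpha)$ means: there exists a finite set $G\subset\mathbb{R}^2$ such that $\pi_{-1}$ (i.e. $(a,b)\mapsto a-b$) is injective on $G$ and $\alpha=\frac{\log|G|}{\max_j \log|\pi_{r_j}(G)|}$. *)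

theory Defs
  imports Complex_Main
begin

datatype slope = Fin rat | Infty

fun proj :: "slope \<Rightarrow> real \<times> real \<Rightarrow> real" where
  "proj (Fin r) (a, b) = a + of_rat r * b"
| "proj Infty (a, b) = b"

definition max_log_proj :: "slope list \<Rightarrow> (real \<times> real) set \<Rightarrow> real" where
  "max_log_proj rs G = Max ((\<lambda>r. ln (real (card (proj r ` G)))) ` set rs)"

text \<open>
  \<open>not_SD [r\<^sub>1, \<dots>, r\<^sub>n] \<alpha>\<close> is the statement written
  \<open>\<not> SD(r\<^sub>1, \<dots>, r\<^sub>n; \<alpha>)\<close>. The slopes are required to differ from
  \<open>-1\<close>. The choice of the base of the logarithm is irrelevant for the quotient. The condition
  that the denominator is nonzero makes the quotient meaningful: it rules out the
  values \<open>x / 0 = 0\<close> of HOL and also the empty set, where \<open>ln 0 = 0\<close> in HOL.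
\<close>

definition not_SD :: "slope list \<Rightarrow> real \<Rightarrow> bool" where
  "not_SD rs \<alpha> \<longleftrightarrow>
     rs \<noteq> [] \<and> Fin (-1) \<notin> set rs \<and>
     (\<exists>G :: (real \<times> real) set.
        finite G \<and> inj_on (proj (Fin (-1))) G \<and>
        max_log_proj rs G \<noteq> 0 \<and>
        \<alpha> = ln (real (card G)) / max_log_proj rs G)"

end

theory Submission
  imports Defs "HOL-Combinatorics.Multiset_Permutations"
begin

text \<open>
  The set \<open>G\<close> is a type class: fix a multiset of 100 integer pairs \<open>(a, b)\<close> for which \<open>a - b\<close>
  determines the pair, and let \<open>G\<close> consist of all its arrangements, each read as a pair of
  integers in base 100 (two lists of first and second components, taken as digits). The map
  \<open>a - b\<close> is injective on \<open>G\<close> because the digits of the difference are small, and for the other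
  slopes \<open>r\<close> an element of \<open>\<pi>\<^sub>r(G)\<close> depends only on an arrangement of the multiset of the values
  \<open>\<pi>\<^sub>r(a, b)\<close>. So all cardinalities are controlled by multinomial coefficients:
  \<open>|G| \<ge> 2^248\<close> and \<open>|\<pi>\<^sub>r(G)|\<^sup>2 \<le> 2^307\<close>. The multiplicities were found by a numerical search
  maximising the ratio of the entropies.
\<close>

text \<open>Modulo \<open>B\<close> only the heads survive, and two heads closer than
  \<open>B\<close> must agree. Bounding differences rather than digits admits negative
  entries.\<close>

lemma horner_sum_inj:
  fixes B :: int
  assumes "length xs = length ys"
    and "\<And>x y. x \<in> set xs \<Longrightarrow> y \<in> set ys \<Longrightarrow> \<bar>x - y\<bar> < B"
    and "horner_sum id B xs = horner_sum id B ys"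
  shows "xs = ys"
  using assms
proof (induction xs ys rule: list_induct2)
  case Nil
  then show ?case by simp
next
  case (Cons x xs y ys)
  have eq: "x - y = B * (horner_sum id B ys - horner_sum id B xs)"
    using Cons.prems(2) by (simp add: algebra_simps id_def)
  have less: "\<bar>x - y\<bar> < B"
    using Cons.prems(1) by simp
  have "x = y"
  proof (rule ccontr)
    assume "x \<noteq> y"
    moreover have "B dvd x - y"
      using eq by simp
    ultimately have "\<bar>B\<bar> \<le> \<bar>x - y\<bar>"
      by (intro dvd_imp_le_int) simp_all
    with less show False by linarith
  qed
  \<comment> \<open>The bound on the difference of the heads forces \<open>B\<close> to be positive,
    so it can be cancelled.\<close>
  moreover from this eq less have "horner_sum id B xs = horner_sum id B ys"
    by auto
  ultimately show ?case
    using Cons.IH Cons.prems(1) by (simp add: id_def)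
qed

lemma horner_sum_map_id: "horner_sum f B xs = horner_sum id B (map f xs)"
  by (induction xs) simp_all

text \<open>Both coordinates use the same base and digits are not normalised, so an integral
  combination of the coordinates acts entry by entry on the list.\<close>

definition encode :: "(int \<times> int) list \<Rightarrow> real \<times> real" where
  "encode xs = (of_int (horner_sum fst 100 xs), of_int (horner_sum snd 100 xs))"

lemma proj_Fin_encode:
  "proj (Fin (of_int c)) (encode xs) = of_int (horner_sum (\<lambda>(a, b). a + c * b) 100 xs)"
  by (induction xs) (auto simp: encode_def algebra_simps)

lemma proj_Infty_encode:
  "proj Infty (encode xs) = of_int (horner_sum snd 100 xs)"
  by (simp add: encode_def)

text \<open>Differences below 50 in absolute value lie less than 100 apart, so the base 100 value
  determines each of them, and each determines its pair.\<close>

lemma inj_on_proj_encode: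
  assumes inj: "inj_on (\<lambda>(a, b). a - b) (set_mset A)"
    and small: "\<And>a b. (a, b) \<in># A \<Longrightarrow> \<bar>a - b\<bar> < 50"
  shows "inj_on (\<lambda>xs. proj (Fin (- 1)) (encode xs)) (permutations_of_multiset A)"
proof (rule inj_onI)
  let ?d = "\<lambda>(a, b). a - b :: int"
  fix xs ys
  assume xs: "xs \<in> permutations_of_multiset A" and ys: "ys \<in> permutations_of_multiset A"
    and "proj (Fin (- 1)) (encode xs) = proj (Fin (- 1)) (encode ys)"
  then have eq: "horner_sum id 100 (map ?d xs) = horner_sum id 100 (map ?d ys)"
    using proj_Fin_encode[of "-1"] by (simp add: horner_sum_map_id[symmetric])
  have mset: "mset xs = A" "mset ys = A"
    using xs ys by (auto dest: permutations_of_multisetD)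
  then have set: "set xs = set_mset A" "set ys = set_mset A"
    by (auto simp flip: set_mset_mset)
  have "length xs = length ys"
    using mset by (metis size_mset)
  have "map ?d xs = map ?d ys"
  proof (rule horner_sum_inj[OF _ _ eq])
    show "length (map ?d xs) = length (map ?d ys)"
      using \<open>length xs = length ys\<close> by simp
    show "\<bar>x - y\<bar> < 100" if "x \<in> set (map ?d xs)" "y \<in> set (map ?d ys)" for x y
      using that set by (force dest!: small)
  qed
  then show "xs = ys"
    using inj set by (simp add: inj_on_map_eq_map)
qed

text \<open>The map \<open>h\<close> factors through \<open>map f\<close>, which sends arrangements
  of \<open>A\<close> to arrangements of \<open>image_mset f A\<close>.\<close>

lemma card_image_horner_sum_le:
  assumes "\<And>xs. h xs = of_int (horner_sum f 100 xs)"
  shows "card (h ` permutations_of_multiset A) \<le> card (permutations_of_multiset (image_mset f A))"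
proof -
  have "h ` permutations_of_multiset A \<subseteq>
      (\<lambda>zs. of_int (horner_sum id 100 zs)) ` permutations_of_multiset (image_mset f A)"
  proof safe
    fix xs
    assume "xs \<in> permutations_of_multiset A"
    then have "map f xs \<in> permutations_of_multiset (image_mset f A)"
      by (auto simp: permutations_of_multiset_def)
    moreover have "h xs = of_int (horner_sum id 100 (map f xs))"
      by (simp add: assms horner_sum_map_id[symmetric])
    ultimately show "h xs \<in> (\<lambda>zs. of_int (horner_sum id 100 zs)) `
        permutations_of_multiset (image_mset f A)"
      by blast
  qed
  then show ?thesis
    by (meson card_image_le card_mono finite_imageI finite_permutations_of_multiset le_trans)
qed

definition pairs :: "(int \<times> int) multiset" where
  "pairs =
     replicate_mset 1 (0, 7) + replicate_mset 2 (2, 4) + replicate_mset 18 (2, 5) +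
     replicate_mset 1 (2, 6) + replicate_mset 1 (2, 7) + replicate_mset 23 (4, 3) +
     replicate_mset 6 (4, 4) + replicate_mset 24 (4, 5) + replicate_mset 19 (6, 3) +
     replicate_mset 3 (6, 4) + replicate_mset 1 (8, 1) + replicate_mset 1 (8, 3)"

lemma set_mset_pairs:
  "set_mset pairs = {(0, 7), (2, 4), (2, 5), (2, 6), (2, 7), (4, 3), (4, 4), (4, 5), (6, 3),
     (6, 4), (8, 1), (8, 3)}"
  by (auto simp: pairs_def)

lemma card_arrangements_pairs: "card (permutations_of_multiset pairs) \<ge> 2 ^ 248"
  by (simp add: card_permutations_of_multiset set_mset_pairs) (simp add: pairs_def fact_numeral)

text \<open>Squaring expresses the bound 2^153.5 in integers. The half matters: 248/154 is below
  1.6104, while 248/153.5 exceeds 1.615.\<close>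

lemma card_arrangements_sums:
  "card (permutations_of_multiset (image_mset (\<lambda>(a, b). a) pairs)) ^ 2 \<le> 2 ^ 307"
  "card (permutations_of_multiset (image_mset (\<lambda>(a, b). a + b) pairs)) ^ 2 \<le> 2 ^ 307"
  "card (permutations_of_multiset (image_mset (\<lambda>(a, b). a + 2 * b) pairs)) ^ 2 \<le> 2 ^ 307"
  "card (permutations_of_multiset (image_mset snd pairs)) ^ 2 \<le> 2 ^ 307"
  \<comment> \<open>Different pairs can have the same image, so the set of values is listed with
    repetitions; \<open>prod.insert_if\<close> handles them.\<close>
  by (simp_all add: card_permutations_of_multiset set_mset_pairs prod.insert_if)
    (simp_all add: pairs_def fact_numeral)

theorem theorem2:
  "\<exists>\<alpha>::real. \<alpha> > 1.61226 \<and> not_SD [Fin 0, Fin 1, Fin 2, Infty] \<alpha>"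
proof -
  let ?rs = "[Fin 0, Fin 1, Fin 2, Infty]"
  define G where "G = encode ` permutations_of_multiset pairs"
  define M where "M = max_log_proj ?rs G"
  have fin: "finite G"
    by (simp add: G_def)
  have inj: "inj_on (\<lambda>xs. proj (Fin (- 1)) (encode xs)) (permutations_of_multiset pairs)"
    by (rule inj_on_proj_encode) (auto simp: set_mset_pairs)
  then have inj_proj: "inj_on (proj (Fin (- 1))) G"
    unfolding G_def by (auto simp: inj_on_def)
  have "inj_on encode (permutations_of_multiset pairs)"
    using inj by (auto simp: inj_on_def)
  then have card_G: "card G \<ge> 2 ^ 248"
    using card_arrangements_pairs by (simp add: G_def card_image)

  have card_proj: "card (proj r ` G) ^ 2 \<le> 2 ^ 307" if "r \<in> set ?rs" for r
  proof -
    have *: "card (proj r ` G) ^ 2 \<le> 2 ^ 307"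
      if "\<And>xs. proj r (encode xs) = of_int (horner_sum f 100 xs)"
        "card (permutations_of_multiset (image_mset f pairs)) ^ 2 \<le> 2 ^ 307" for f
      using card_image_horner_sum_le[of "\<lambda>xs. proj r (encode xs)", OF that(1), of pairs] that(2)
      unfolding G_def image_image by (meson le_trans power_mono zero_le)
    from \<open>r \<in> set ?rs\<close> consider "r = Fin 0" | "r = Fin 1" | "r = Fin 2" | "r = Infty"
      by auto
    then show ?thesis
      using *[OF _ card_arrangements_sums(1)] *[OF _ card_arrangements_sums(2)]
        *[OF _ card_arrangements_sums(3)] *[OF _ card_arrangements_sums(4)]
        proj_Fin_encode[of 0] proj_Fin_encode[of 1] proj_Fin_encode[of 2] proj_Infty_encode
      by cases simp_all
  qed

  have ln_le_M: "ln (real (card (proj r ` G))) \<le> M" if "r \<in> set ?rs" for r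
    unfolding M_def max_log_proj_def using that by (intro Max_ge) auto
  have card_pos: "card (proj r ` G) > 0" for r
    using fin card_G by (auto simp: card_gt_0_iff)
  have "2 * ln (real (card (proj r ` G))) \<le> 307 * ln 2" if "r \<in> set ?rs" for r
  proof -
    have "real (card (proj r ` G) ^ 2) \<le> 2 ^ 307"
      using card_proj[OF that] by (metis of_nat_le_iff of_nat_numeral of_nat_power)
    then have "ln (real (card (proj r ` G)) ^ 2) \<le> ln (2 ^ 307)"
      using card_pos by (subst ln_le_cancel_iff) simp_all
    then show ?thesis
      using card_pos ln_realpow[of 2 307] by (simp add: ln_realpow)
  qed
  moreover have "M \<in> (\<lambda>r. ln (real (card (proj r ` G)))) ` set ?rs"
    unfolding M_def max_log_proj_def by (rule Max_in) auto
  ultimately have M_le: "2 * M \<le> 307 * ln 2"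
    by blast

  have ln_G: "248 * ln 2 \<le> ln (real (card G))"
  proof -
    have "2 ^ 248 \<le> real (card G)"
      using card_G by (metis of_nat_le_iff of_nat_numeral of_nat_power)
    then have "ln (2 ^ 248) \<le> ln (real (card G))"
      by (subst ln_le_cancel_iff) auto
    then show ?thesis using ln_realpow[of 2 248] by simp
  qed

  \<comment> \<open>Slopes 0 and \<open>Infty\<close> give the two coordinates, so log |G| is at
    most 2 \<open>M\<close>. As |G| is large, \<open>M\<close> is positive and division by it is
    legitimate.\<close>
  have "G \<subseteq> proj (Fin 0) ` G \<times> proj Infty ` G"
    by force
  then have "card G \<le> card (proj (Fin 0) ` G) * card (proj Infty ` G)"
    using fin by (metis card_cartesian_product card_mono finite_SigmaI finite_imageI)
  then have "ln (real (card G)) \<le>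
      ln (real (card (proj (Fin 0) ` G)) * real (card (proj Infty ` G)))"
    using card_G card_pos by (subst ln_le_cancel_iff) (simp_all flip: of_nat_mult)
  also have "\<dots> \<le> M + M"
    using ln_le_M[of "Fin 0"] ln_le_M[of Infty] card_pos by (simp add: ln_mult)
  finally have "M > 0"
    using ln_G ln_gt_zero[of "2::real"] by linarith

  \<comment> \<open>Numerically, 1.61226 * 153.5 is about 247.48.\<close>
  have "1.61226 * M < 248 * ln 2"
    using M_le \<open>M > 0\<close> ln_gt_zero[of "2::real"] by simp
  with ln_G have "1.61226 < ln (real (card G)) / M"
    using \<open>M > 0\<close> by (simp add: less_divide_eq)
  moreover have "not_SD ?rs (ln (real (card G)) / M)"
    unfolding not_SD_def using fin inj_proj \<open>M > 0\<close> by (auto simp: M_def)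
  ultimately show ?thesis by blast
qed

end
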